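(* Let $(S,+)$ be a Clifford semigroup and $(U,V)$ an exact factorization of $S$ into two Clifford subsemigroups. Define on $S$ the operation given by $$a\circ b:=u_a+b+v_a\qquad\text{for all } a,b\in S,$$ where $a=u_a+v_a$ is the unique decomposition of $a$ with $u_a\in U$, $v_a\in V$. Then $S_\circ:=(S,+,\circ)$ is a weak brace and its multiplicative semigroup $(S,\circ)$ is isomorphic to the additive semigroup $U\times V$ (direct product). Moreover, with respect to the operations of $S_\circ$, $U$ and $V$ are the trivial and the almost trivial weak braces, respectively; i.e. $a\circ b=a+b$ for all $a,b\in U$, and $a\circ b=b+a$ for all $a,b\in V$.
   Context: A semigroup is inverse if each element $a$ has a unique inverse, i.e. a unique $x$ with $axa=a$ and $xax=x$. A Clifford semigroup is an inverse semigroup whose idempotents are central; additive notation does not imply commutativity. A weak (left) brace is a non-empty set $S$ with two binary operations $+$ and $\circ$ such that $(S,+)$ and $(S,\circ)$ are both inverse semigroups and, for all $a,b,c\in S$, $a\circ(b+c)=a\circ b-a+a\circ c$ and $a\circ a^-=-a+a$, where $-a$ is the inverse of $a$ in $(S,+)$, $a^-$ is the inverse of $a$ in $(S,\circ)$, and $\circ$ has higher precedence than $+$. An exact factorization of a semigroup $(S,+)$ is a pair $(U,V)$ of subsemigroups of $S$ such that every $a\in S$ can be written in a unique way as $a=u_a+v_a$ with $u_a\in U$ and $v_a\in V$. *)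

theory Defs
  imports Main
begin

text \<open>Semigroups are given by an explicit carrier, since subsemigroups and the restriction
  of operations to them are needed. As usual, semigroups are non-empty.\<close>

locale semigroup_on =
  fixes S :: "'a set" and f :: "'a \<Rightarrow> 'a \<Rightarrow> 'a" (infixl "\<cdot>" 70)
  assumes nonempty: "S \<noteq> {}"
    and closed: "a \<in> S \<Longrightarrow> b \<in> S \<Longrightarrow> a \<cdot> b \<in> S"
    and assoc: "a \<in> S \<Longrightarrow> b \<in> S \<Longrightarrow> c \<in> S \<Longrightarrow> (a \<cdot> b) \<cdot> c = a \<cdot> (b \<cdot> c)"

locale inverse_semigroup = semigroup_on S f
  for S :: "'a set" and f :: "'a \<Rightarrow> 'a \<Rightarrow> 'a" (infixl "\<cdot>" 70) +
  assumes ex1_inverse: "a \<in> S \<Longrightarrow> \<exists>!x. x \<in> S \<and> a \<cdot> x \<cdot> a = a \<and> x \<cdot> a \<cdot> x = x"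
begin

definition inverse_of :: "'a \<Rightarrow> 'a" where
  "inverse_of a = (THE x. x \<in> S \<and> a \<cdot> x \<cdot> a = a \<and> x \<cdot> a \<cdot> x = x)"

end

locale clifford_semigroup = inverse_semigroup S f
  for S :: "'a set" and f :: "'a \<Rightarrow> 'a \<Rightarrow> 'a" (infixl "\<cdot>" 70) +
  assumes idem_central: "e \<in> S \<Longrightarrow> e \<cdot> e = e \<Longrightarrow> a \<in> S \<Longrightarrow> e \<cdot> a = a \<cdot> e"

locale weak_brace =
  additive: inverse_semigroup S add + multiplicative: inverse_semigroup S circ
  for S :: "'a set"
    and add :: "'a \<Rightarrow> 'a \<Rightarrow> 'a" (infixl "\<oplus>" 65)
    and circ :: "'a \<Rightarrow> 'a \<Rightarrow> 'a" (infixl "\<odot>" 70) +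
  assumes distrib: "a \<in> S \<Longrightarrow> b \<in> S \<Longrightarrow> c \<in> S \<Longrightarrow>
      a \<odot> (b \<oplus> c) = a \<odot> b \<oplus> additive.inverse_of a \<oplus> a \<odot> c"
    and circ_inverse: "a \<in> S \<Longrightarrow>
      a \<odot> multiplicative.inverse_of a = additive.inverse_of a \<oplus> a"

locale trivial_weak_brace = weak_brace S add circ
  for S :: "'a set"
    and add :: "'a \<Rightarrow> 'a \<Rightarrow> 'a" (infixl "\<oplus>" 65)
    and circ :: "'a \<Rightarrow> 'a \<Rightarrow> 'a" (infixl "\<odot>" 70) +
  assumes circ_eq: "a \<in> S \<Longrightarrow> b \<in> S \<Longrightarrow> a \<odot> b = a \<oplus> b"

locale almost_trivial_weak_brace = weak_brace S add circ
  for S :: "'a set"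
    and add :: "'a \<Rightarrow> 'a \<Rightarrow> 'a" (infixl "\<oplus>" 65)
    and circ :: "'a \<Rightarrow> 'a \<Rightarrow> 'a" (infixl "\<odot>" 70) +
  assumes circ_eq: "a \<in> S \<Longrightarrow> b \<in> S \<Longrightarrow> a \<odot> b = b \<oplus> a"

definition subsemigroup_on :: "'a set \<Rightarrow> 'a set \<Rightarrow> ('a \<Rightarrow> 'a \<Rightarrow> 'a) \<Rightarrow> bool" where
  "subsemigroup_on U S f \<longleftrightarrow>
     U \<noteq> {} \<and> U \<subseteq> S \<and> (\<forall>a\<in>U. \<forall>b\<in>U. f a b \<in> U)"

definition exact_factorization ::
    "'a set \<Rightarrow> ('a \<Rightarrow> 'a \<Rightarrow> 'a) \<Rightarrow> 'a set \<Rightarrow> 'a set \<Rightarrow> bool" where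
  "exact_factorization S add U V \<longleftrightarrow>
     subsemigroup_on U S add \<and> subsemigroup_on V S add \<and>
     (\<forall>a\<in>S. \<exists>!p. p \<in> U \<times> V \<and> a = add (fst p) (snd p))"

text \<open>The pair \<open>(u\<^sub>a, v\<^sub>a)\<close>; meaningful for \<open>a\<close> in the factorized semigroup only.\<close>

definition decomposition ::
    "('a \<Rightarrow> 'a \<Rightarrow> 'a) \<Rightarrow> 'a set \<Rightarrow> 'a set \<Rightarrow> 'a \<Rightarrow> 'a \<times> 'a" where
  "decomposition add U V a = (THE p. p \<in> U \<times> V \<and> a = add (fst p) (snd p))"

definition factorization_circ ::
    "('a \<Rightarrow> 'a \<Rightarrow> 'a) \<Rightarrow> 'a set \<Rightarrow> 'a set \<Rightarrow> 'a \<Rightarrow> 'a \<Rightarrow> 'a" where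
  "factorization_circ add U V a b =
     add (add (fst (decomposition add U V a)) b) (snd (decomposition add U V a))"

definition direct_product_op ::
    "('a \<Rightarrow> 'a \<Rightarrow> 'a) \<Rightarrow> ('b \<Rightarrow> 'b \<Rightarrow> 'b) \<Rightarrow> 'a \<times> 'b \<Rightarrow> 'a \<times> 'b \<Rightarrow> 'a \<times> 'b" where
  "direct_product_op f g p q = (f (fst p) (fst q), g (snd p) (snd q))"

definition semigroups_isomorphic ::
    "'a set \<Rightarrow> ('a \<Rightarrow> 'a \<Rightarrow> 'a) \<Rightarrow> 'b set \<Rightarrow> ('b \<Rightarrow> 'b \<Rightarrow> 'b) \<Rightarrow> bool" where
  "semigroups_isomorphic S f T g \<longleftrightarrow>
     (\<exists>\<phi>. bij_betw \<phi> S T \<and> (\<forall>a\<in>S. \<forall>b\<in>S. \<phi> (f a b) = g (\<phi> a) (\<phi> b)))"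

end

theory Submission
  imports Defs
begin

text \<open>Write \<open>-a\<close> for the additive inverse of \<open>a\<close>.  If \<open>a = u\<^sub>a + v\<^sub>a\<close> and \<open>b = u\<^sub>b + v\<^sub>b\<close>, then
  \<open>a \<circ> b = (u\<^sub>a + u\<^sub>b) + (v\<^sub>b + v\<^sub>a)\<close>.  As \<open>U\<close> and \<open>V\<close> are closed under addition, the two brackets
  are the components of \<open>a \<circ> b\<close>.  Hence \<open>a \<mapsto> (u\<^sub>a, v\<^sub>a)\<close> identifies \<open>(S, \<circ>)\<close> with the product of \<open>U\<close>
  and the opposite of \<open>V\<close>, and since inversion is an isomorphism from the opposite of \<open>V\<close> onto \<open>V\<close>,
  the map \<open>a \<mapsto> (u\<^sub>a, -v\<^sub>a)\<close> is an isomorphism of \<open>(S, \<circ>)\<close> onto \<open>U \<times> V\<close>.  In particular \<open>(S, \<circ>)\<close> is an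
  inverse semigroup, in which \<open>a\<close> has the inverse \<open>(-u\<^sub>a) + (-v\<^sub>a)\<close>.

  The two axioms relating \<open>+\<close> and \<open>\<circ>\<close> become calculations with the idempotents \<open>u\<^sub>a - u\<^sub>a\<close> and
  \<open>v\<^sub>a - v\<^sub>a\<close>.  They are central, so in
  \<open>a \<circ> b - a + a \<circ> c = u\<^sub>a + b + (v\<^sub>a - v\<^sub>a) + (- u\<^sub>a + u\<^sub>a) + c + v\<^sub>a\<close> they can be moved outwards and
  absorbed by \<open>u\<^sub>a\<close> and \<open>v\<^sub>a\<close>, which leaves \<open>a \<circ> (b + c)\<close>.

  For the last claim, let \<open>a \<in> U\<close>.  Then \<open>a + (v\<^sub>a - v\<^sub>a) = a\<close> is a decomposition of \<open>a\<close> with first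
  component \<open>a\<close>, so uniqueness gives \<open>u\<^sub>a = a\<close> and shows that \<open>v\<^sub>a\<close> is an idempotent absorbed by \<open>a\<close>.
  Being central, it disappears from \<open>a + b + v\<^sub>a\<close>.  The case of \<open>V\<close> is symmetric.\<close>

section \<open>Inverse semigroups and Clifford semigroups\<close>

context inverse_semigroup
begin

lemma inverse_of_props:
  assumes "a \<in> S"
  shows inverse_of_closed: "inverse_of a \<in> S"
    and mult_inverse_mult: "a \<cdot> inverse_of a \<cdot> a = a"
    and inverse_mult_inverse: "inverse_of a \<cdot> a \<cdot> inverse_of a = inverse_of a"
  using theI'[OF ex1_inverse[OF assms]] unfolding inverse_of_def by blast+

lemma inverse_of_eqI:
  assumes "a \<in> S" "x \<in> S" "a \<cdot> x \<cdot> a = a" "x \<cdot> a \<cdot> x = x"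
  shows "inverse_of a = x"
  using ex1_inverse[OF assms(1)] inverse_of_props[OF assms(1)] assms by blast

lemma inverse_of_inverse_of:
  assumes "a \<in> S"
  shows "inverse_of (inverse_of a) = a"
  using assms by (intro inverse_of_eqI) (simp_all add: inverse_of_props)

lemma bij_betw_inverse_of: "bij_betw inverse_of S S"
  by (rule bij_betw_byWitness[where f' = inverse_of])
    (auto simp: inverse_of_inverse_of inverse_of_closed)

lemma mult_inverse_idem:
  assumes "a \<in> S"
  shows "(a \<cdot> inverse_of a) \<cdot> (a \<cdot> inverse_of a) = a \<cdot> inverse_of a"
  using assms by (metis assoc closed inverse_of_closed mult_inverse_mult)

lemma inverse_mult_idem:
  assumes "a \<in> S"
  shows "(inverse_of a \<cdot> a) \<cdot> (inverse_of a \<cdot> a) = inverse_of a \<cdot> a"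
  using assms by (metis assoc closed inverse_of_closed mult_inverse_mult)

text \<open>Injectivity of \<open>\<phi>\<close> reflects the equations from \<open>S\<close> to \<open>T\<close>, and surjectivity provides an
  element of \<open>T\<close> over the inverse of \<open>\<phi> a\<close>.  Taking for \<open>\<phi>\<close> the identity, inversion, or an isomorphism onto a direct product gives every
  inverse semigroup constructed below.\<close>

lemma inverse_semigroup_pullback:
  assumes bij: "bij_betw \<phi> T S"
    and cl: "\<And>a b. a \<in> T \<Longrightarrow> b \<in> T \<Longrightarrow> g a b \<in> T"
    and hom: "\<And>a b. a \<in> T \<Longrightarrow> b \<in> T \<Longrightarrow> \<phi> (g a b) = \<phi> a \<cdot> \<phi> b"
  shows "inverse_semigroup T g"
proof
  have mem: "\<phi> a \<in> S" if "a \<in> T" for a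
    using bij that by (auto simp: bij_betw_def)
  have eq_iff: "a = b \<longleftrightarrow> \<phi> a = \<phi> b" if "a \<in> T" "b \<in> T" for a b
    using bij that by (auto simp: bij_betw_def inj_on_def)
  show "T \<noteq> {}"
    using bij nonempty by (auto simp: bij_betw_def)
  show "g a b \<in> T" if "a \<in> T" "b \<in> T" for a b
    using cl that .
  show "g (g a b) c = g a (g b c)" if "a \<in> T" "b \<in> T" "c \<in> T" for a b c
    using that by (simp add: eq_iff cl hom mem assoc)
  show "\<exists>!x. x \<in> T \<and> g (g a x) a = a \<and> g (g x a) x = x" if a: "a \<in> T" for a
  proof -
    have transfer: "g (g a x) a = a \<and> g (g x a) x = x \<longleftrightarrow>
        \<phi> a \<cdot> \<phi> x \<cdot> \<phi> a = \<phi> a \<and> \<phi> x \<cdot> \<phi> a \<cdot> \<phi> x = \<phi> x" if "x \<in> T" for x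
      using a that by (simp add: eq_iff cl hom)
    obtain x where x: "x \<in> T" "\<phi> x = inverse_of (\<phi> a)"
      using bij inverse_of_closed[OF mem[OF a]] by (auto simp: bij_betw_def)
    show ?thesis
    proof (rule ex1I)
      show "x \<in> T \<and> g (g a x) a = a \<and> g (g x a) x = x"
        using x transfer[OF x(1)] inverse_of_props[OF mem[OF a]] by simp
      show "y = x" if "y \<in> T \<and> g (g a y) a = a \<and> g (g y a) y = y" for y
        using that x transfer[of y] inverse_of_eqI[OF mem[OF a] mem[of y]] eq_iff[of y x] by auto
    qed
  qed
qed

end

lemma inverse_semigroup_direct_product:
  assumes "inverse_semigroup A f" "inverse_semigroup B g"
  shows "inverse_semigroup (A \<times> B) (direct_product_op f g)"
proof -
  interpret A: inverse_semigroup A f by fact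
  interpret B: inverse_semigroup B g by fact
  show ?thesis
  proof
    fix p assume p: "p \<in> A \<times> B"
    let ?q = "(A.inverse_of (fst p), B.inverse_of (snd p))"
    show "\<exists>!x. x \<in> A \<times> B
        \<and> direct_product_op f g (direct_product_op f g p x) p = p
        \<and> direct_product_op f g (direct_product_op f g x p) x = x"
      using p A.inverse_of_props[of "fst p"] B.inverse_of_props[of "snd p"]
      by (intro ex1I[of _ ?q])
        (auto simp: direct_product_op_def prod_eq_iff
          intro!: A.inverse_of_eqI[symmetric] B.inverse_of_eqI[symmetric])
  qed (use A.nonempty B.nonempty in
      \<open>auto simp: direct_product_op_def A.closed B.closed A.assoc B.assoc\<close>)
qed

context clifford_semigroup
begin

text \<open>With \<open>e = a a\<^sup>-\<^sup>1\<close> and \<open>f = a\<^sup>-\<^sup>1 a\<close>, moving \<open>f\<close> in \<open>a f a\<^sup>-\<^sup>1\<close> and \<open>e\<close> in \<open>a\<^sup>-\<^sup>1 e a\<close> to the front shows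
  \<open>e = f e\<close> and \<open>f = e f\<close>, so \<open>e = f\<close> by centrality.\<close>

lemma inverse_mult_commute:
  assumes a: "a \<in> S"
  shows "inverse_of a \<cdot> a = a \<cdot> inverse_of a"
proof -
  define a' where "a' = inverse_of a"
  note props = inverse_of_props[OF a, folded a'_def]
  have e: "a \<cdot> a' \<in> S" "a' \<cdot> a \<in> S"
    using a props by (auto intro: closed)
  have "a \<cdot> a' = (a \<cdot> (a' \<cdot> a)) \<cdot> a'"
    using a props by (simp add: assoc closed)
  also have "\<dots> = (a' \<cdot> a) \<cdot> (a \<cdot> a')"
    using idem_central[OF e(2) inverse_mult_idem[OF a, folded a'_def] a] a props e
    by (metis assoc)
  finally have 1: "a \<cdot> a' = (a' \<cdot> a) \<cdot> (a \<cdot> a')" .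
  have "a' \<cdot> a = (a' \<cdot> (a \<cdot> a')) \<cdot> a"
    using a props by (metis assoc)
  also have "\<dots> = (a \<cdot> a') \<cdot> (a' \<cdot> a)"
    using idem_central[OF e(1) mult_inverse_idem[OF a, folded a'_def] props(1)] a props e
    by (metis assoc)
  also have "\<dots> = (a' \<cdot> a) \<cdot> (a \<cdot> a')"
    using idem_central[OF e(1) mult_inverse_idem[OF a, folded a'_def] e(2)] .
  finally show ?thesis
    using 1 unfolding a'_def by simp
qed

definition idem_of :: "'a \<Rightarrow> 'a" where
  "idem_of a = a \<cdot> inverse_of a"

lemma
  assumes a: "a \<in> S"
  shows idem_of_closed: "idem_of a \<in> S"
    and idem_of_idem: "idem_of a \<cdot> idem_of a = idem_of a"
    and mult_inverse_eq: "a \<cdot> inverse_of a = idem_of a"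
    and inverse_mult_eq: "inverse_of a \<cdot> a = idem_of a"
    and idem_of_mult: "idem_of a \<cdot> a = a"
    and mult_idem_of: "a \<cdot> idem_of a = a"
    and idem_of_mult_inverse: "idem_of a \<cdot> inverse_of a = inverse_of a"
proof -
  note props = inverse_of_props[OF a]
  show "idem_of a \<in> S" "idem_of a \<cdot> idem_of a = idem_of a" "a \<cdot> inverse_of a = idem_of a"
    "inverse_of a \<cdot> a = idem_of a" "idem_of a \<cdot> a = a"
    using a props by (simp_all add: idem_of_def closed mult_inverse_idem inverse_mult_commute)
  show "a \<cdot> idem_of a = a"
    using a props by (metis assoc idem_of_def inverse_mult_commute)
  show "idem_of a \<cdot> inverse_of a = inverse_of a"
    using a props by (metis idem_of_def inverse_mult_commute)
qed

lemma idem_of_commute: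
  assumes "a \<in> S" "b \<in> S"
  shows "idem_of a \<cdot> b = b \<cdot> idem_of a"
  using assms by (intro idem_central idem_of_closed idem_of_idem)

lemma inverse_of_mult:
  assumes a: "a \<in> S" and b: "b \<in> S"
  shows "inverse_of (a \<cdot> b) = inverse_of b \<cdot> inverse_of a"
proof (rule inverse_of_eqI)
  note mem = a b inverse_of_closed[OF a] inverse_of_closed[OF b]
    idem_of_closed[OF a] idem_of_closed[OF b]
  show "a \<cdot> b \<in> S" "inverse_of b \<cdot> inverse_of a \<in> S"
    using mem by (simp_all add: closed)
  have ab: "(a \<cdot> b) \<cdot> (inverse_of b \<cdot> inverse_of a) = idem_of a \<cdot> idem_of b"
  proof -
    have "(a \<cdot> b) \<cdot> (inverse_of b \<cdot> inverse_of a) = a \<cdot> idem_of b \<cdot> inverse_of a"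
      using mem mult_inverse_eq[OF b] by (metis assoc closed)
    also have "\<dots> = idem_of b \<cdot> idem_of a"
      using mem idem_of_commute[OF b a] mult_inverse_eq[OF a] by (metis assoc)
    finally show ?thesis
      using idem_of_commute[OF b mem(5)] by simp
  qed
  show "(a \<cdot> b) \<cdot> (inverse_of b \<cdot> inverse_of a) \<cdot> (a \<cdot> b) = a \<cdot> b"
    unfolding ab using mem idem_of_commute[OF b a] idem_of_mult[OF a] idem_of_mult[OF b]
    by (metis assoc closed)
  have "inverse_of b \<cdot> inverse_of a \<cdot> (a \<cdot> b) \<cdot> (inverse_of b \<cdot> inverse_of a)
      = inverse_of b \<cdot> inverse_of a \<cdot> (idem_of a \<cdot> idem_of b)"
    using ab mem by (metis assoc closed)
  also have "\<dots> = (idem_of b \<cdot> inverse_of b) \<cdot> (idem_of a \<cdot> inverse_of a)"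
    using mem idem_of_commute[OF a] idem_of_commute[OF b] by (metis assoc closed)
  finally show "inverse_of b \<cdot> inverse_of a \<cdot> (a \<cdot> b) \<cdot> (inverse_of b \<cdot> inverse_of a)
      = inverse_of b \<cdot> inverse_of a"
    using idem_of_mult_inverse a b by simp
qed

end

section \<open>Weak braces with explicit inverses\<close>

text \<open>Inverses are determined by their defining equations, so the two axioms linking the operations
  may be verified for any functions \<open>n\<close> and \<open>m\<close> that satisfy these equations.\<close>

lemma weak_braceI:
  assumes add: "inverse_semigroup S add" and circ: "inverse_semigroup S circ"
    and n: "\<And>a. a \<in> S \<Longrightarrow> n a \<in> S \<and> add (add a (n a)) a = a \<and> add (add (n a) a) (n a) = n a"
    and m: "\<And>a. a \<in> S \<Longrightarrow>
      m a \<in> S \<and> circ (circ a (m a)) a = a \<and> circ (circ (m a) a) (m a) = m a"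
    and distrib: "\<And>a b c. a \<in> S \<Longrightarrow> b \<in> S \<Longrightarrow> c \<in> S \<Longrightarrow>
      circ a (add b c) = add (add (circ a b) (n a)) (circ a c)"
    and circ_inverse: "\<And>a. a \<in> S \<Longrightarrow> circ a (m a) = add (n a) a"
  shows "weak_brace S add circ"
proof -
  interpret add: inverse_semigroup S add by fact
  interpret circ: inverse_semigroup S circ by fact
  have "add.inverse_of a = n a" "circ.inverse_of a = m a" if "a \<in> S" for a
    using n[OF that] m[OF that] that by (auto intro: add.inverse_of_eqI circ.inverse_of_eqI)
  then show ?thesis
    using distrib circ_inverse by unfold_locales auto
qed

context clifford_semigroup
begin

lemma trivial_weak_brace_self:
  assumes circ: "\<And>a b. a \<in> S \<Longrightarrow> b \<in> S \<Longrightarrow> circ a b = a \<cdot> b"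
  shows "trivial_weak_brace S (\<cdot>) circ"
proof -
  have "inverse_semigroup S circ"
    by (rule inverse_semigroup_pullback[where \<phi> = id]) (auto simp: circ closed)
  then have "weak_brace S (\<cdot>) circ"
  proof (rule weak_braceI[OF inverse_semigroup_axioms, where n = inverse_of and m = inverse_of])
    fix a b c assume mem: "a \<in> S" "b \<in> S" "c \<in> S"
    have "a \<cdot> b \<cdot> inverse_of a \<cdot> (a \<cdot> c) = a \<cdot> b \<cdot> idem_of a \<cdot> c"
      using mem inverse_of_closed inverse_mult_eq[of a] by (metis assoc closed)
    also have "\<dots> = idem_of a \<cdot> a \<cdot> (b \<cdot> c)"
      using mem idem_of_closed[of a] idem_of_commute[of a "a \<cdot> b"] by (metis assoc closed)
    also have "\<dots> = a \<cdot> (b \<cdot> c)"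
      using mem by (simp add: idem_of_mult)
    finally show "circ a (b \<cdot> c) = circ a b \<cdot> inverse_of a \<cdot> circ a c"
      using mem by (simp add: circ closed)
  qed (auto simp: circ closed inverse_of_props intro: inverse_mult_commute[symmetric])
  then show ?thesis
    using circ by (simp add: trivial_weak_brace_def trivial_weak_brace_axioms_def)
qed

lemma almost_trivial_weak_brace_self:
  assumes circ: "\<And>a b. a \<in> S \<Longrightarrow> b \<in> S \<Longrightarrow> circ a b = b \<cdot> a"
  shows "almost_trivial_weak_brace S (\<cdot>) circ"
proof -
  \<comment> \<open>Inversion reverses products, so it is an isomorphism from the opposite semigroup.\<close>
  have "inverse_semigroup S circ"
    by (rule inverse_semigroup_pullback[OF bij_betw_inverse_of])
      (auto simp: circ closed inverse_of_mult)
  then have "weak_brace S (\<cdot>) circ"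
  proof (rule weak_braceI[OF inverse_semigroup_axioms, where n = inverse_of and m = inverse_of])
    fix a b c assume mem: "a \<in> S" "b \<in> S" "c \<in> S"
    have "b \<cdot> a \<cdot> inverse_of a \<cdot> (c \<cdot> a) = b \<cdot> (idem_of a \<cdot> (c \<cdot> a))"
      using mem inverse_of_closed mult_inverse_eq[of a] by (metis assoc closed)
    also have "\<dots> = b \<cdot> (c \<cdot> (a \<cdot> idem_of a))"
      using mem idem_of_closed[of a] idem_of_commute[of a "c \<cdot> a"] by (simp add: assoc closed)
    also have "\<dots> = (b \<cdot> c) \<cdot> a"
      using mem by (simp add: mult_idem_of assoc)
    finally show "circ a (b \<cdot> c) = circ a b \<cdot> inverse_of a \<cdot> circ a c"
      using mem by (simp add: circ closed)
  next
    fix a assume "a \<in> S"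
    then show "inverse_of a \<in> S \<and> circ (circ a (inverse_of a)) a = a
        \<and> circ (circ (inverse_of a) a) (inverse_of a) = inverse_of a"
      by (simp add: circ closed inverse_of_props assoc[symmetric])
  qed (auto simp: circ inverse_of_closed inverse_of_props)
  then show ?thesis
    using circ by (simp add: almost_trivial_weak_brace_def almost_trivial_weak_brace_axioms_def)
qed

end

section \<open>Exact factorizations of Clifford semigroups\<close>

locale clifford_factorization =
  S: clifford_semigroup S add + U: clifford_semigroup U add + V: clifford_semigroup V add
  for S U V :: "'a set" and add :: "'a \<Rightarrow> 'a \<Rightarrow> 'a" (infixl "\<oplus>" 65) +
  assumes factorization: "exact_factorization S add U V"
begin

abbreviation lpart :: "'a \<Rightarrow> 'a" where
  "lpart a \<equiv> fst (decomposition add U V a)"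

abbreviation rpart :: "'a \<Rightarrow> 'a" where
  "rpart a \<equiv> snd (decomposition add U V a)"

abbreviation circ :: "'a \<Rightarrow> 'a \<Rightarrow> 'a" (infixl "\<odot>" 70) where
  "a \<odot> b \<equiv> factorization_circ add U V a b"

lemma U_subset: "u \<in> U \<Longrightarrow> u \<in> S"
  using factorization by (auto simp: exact_factorization_def subsemigroup_on_def)

lemma V_subset: "v \<in> V \<Longrightarrow> v \<in> S"
  using factorization by (auto simp: exact_factorization_def subsemigroup_on_def)

lemma
  assumes "a \<in> S"
  shows lpart_mem: "lpart a \<in> U"
    and rpart_mem: "rpart a \<in> V"
    and lpart_add_rpart: "lpart a \<oplus> rpart a = a"
proof -
  have "\<exists>!p. p \<in> U \<times> V \<and> a = fst p \<oplus> snd p"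
    using factorization assms by (simp add: exact_factorization_def)
  from theI'[OF this] show "lpart a \<in> U" "rpart a \<in> V" "lpart a \<oplus> rpart a = a"
    by (simp_all add: decomposition_def mem_Times_iff)
qed

lemma decomposition_add:
  assumes u: "u \<in> U" and v: "v \<in> V"
  shows "decomposition add U V (u \<oplus> v) = (u, v)"
proof -
  have "\<exists>!p. p \<in> U \<times> V \<and> u \<oplus> v = fst p \<oplus> snd p"
    using factorization S.closed[OF U_subset[OF u] V_subset[OF v]]
    by (simp add: exact_factorization_def)
  then show ?thesis
    unfolding decomposition_def using u v by (intro the1_equality) auto
qed

lemma U_inverse_of: "u \<in> U \<Longrightarrow> U.inverse_of u = S.inverse_of u"
  using U.inverse_of_props U_subset by (metis S.inverse_of_eqI)

lemma V_inverse_of: "v \<in> V \<Longrightarrow> V.inverse_of v = S.inverse_of v"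
  using V.inverse_of_props V_subset by (metis S.inverse_of_eqI)

lemma circ_parts: "a \<odot> b = lpart a \<oplus> b \<oplus> rpart a"
  by (simp add: factorization_circ_def)

lemma circ_closed:
  assumes "a \<in> S" "b \<in> S"
  shows "a \<odot> b \<in> S"
  using assms U_subset[OF lpart_mem] V_subset[OF rpart_mem] by (simp add: circ_parts S.closed)

lemma decomposition_circ:
  assumes a: "a \<in> S" and b: "b \<in> S"
  shows "decomposition add U V (a \<odot> b) = (lpart a \<oplus> lpart b, rpart b \<oplus> rpart a)"
proof -
  note mem = lpart_mem[OF a] lpart_mem[OF b] rpart_mem[OF a] rpart_mem[OF b]
  note memS = mem(1,2)[THEN U_subset] mem(3,4)[THEN V_subset]
  have "a \<odot> b = (lpart a \<oplus> lpart b) \<oplus> (rpart b \<oplus> rpart a)"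
    using memS lpart_add_rpart[OF b] b unfolding circ_parts by (metis S.assoc S.closed)
  then show ?thesis
    using mem by (simp add: decomposition_add U.closed V.closed)
qed

subsection \<open>The multiplicative semigroup\<close>

text \<open>Inversion in the second component undoes the reversal of \<open>V\<close> in \<open>decomposition_circ\<close>.\<close>

definition product_map :: "'a \<Rightarrow> 'a \<times> 'a" where
  "product_map a = (lpart a, V.inverse_of (rpart a))"

lemma bij_betw_product_map: "bij_betw product_map S (U \<times> V)"
proof (rule bij_betw_byWitness[where f' = "\<lambda>p. fst p \<oplus> V.inverse_of (snd p)"])
  show "\<forall>a\<in>S. fst (product_map a) \<oplus> V.inverse_of (snd (product_map a)) = a"
    by (simp add: product_map_def V.inverse_of_inverse_of rpart_mem lpart_add_rpart)
  show "\<forall>p\<in>U \<times> V. product_map (fst p \<oplus> V.inverse_of (snd p)) = p"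
    by (auto simp: product_map_def decomposition_add V.inverse_of_closed V.inverse_of_inverse_of)
  show "product_map ` S \<subseteq> U \<times> V"
    by (auto simp: product_map_def lpart_mem rpart_mem V.inverse_of_closed)
  show "(\<lambda>p. fst p \<oplus> V.inverse_of (snd p)) ` (U \<times> V) \<subseteq> S"
    by (auto simp: S.closed U_subset V_subset V.inverse_of_closed)
qed

lemma product_map_circ:
  assumes "a \<in> S" "b \<in> S"
  shows "product_map (a \<odot> b) = direct_product_op add add (product_map a) (product_map b)"
  using assms by (simp add: product_map_def decomposition_circ direct_product_op_def
      V.inverse_of_mult rpart_mem)

lemma inverse_semigroup_circ: "inverse_semigroup S circ"
proof -
  interpret UV: inverse_semigroup "U \<times> V" "direct_product_op add add"
    by (rule inverse_semigroup_direct_product[OF U.inverse_semigroup_axioms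
          V.inverse_semigroup_axioms])
  show ?thesis
    using circ_closed product_map_circ
    by (rule UV.inverse_semigroup_pullback[OF bij_betw_product_map])
qed

definition circ_inv :: "'a \<Rightarrow> 'a" where
  "circ_inv a = U.inverse_of (lpart a) \<oplus> V.inverse_of (rpart a)"

lemma decomposition_circ_inv:
  assumes "a \<in> S"
  shows "decomposition add U V (circ_inv a) = (U.inverse_of (lpart a), V.inverse_of (rpart a))"
  using assms unfolding circ_inv_def
  by (intro decomposition_add U.inverse_of_closed V.inverse_of_closed lpart_mem rpart_mem)

lemma circ_inv_closed:
  assumes "a \<in> S"
  shows "circ_inv a \<in> S"
  using assms by (simp add: circ_inv_def S.closed U_subset V_subset U.inverse_of_closed
      V.inverse_of_closed lpart_mem rpart_mem)

lemma eq_by_decomposition: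
  assumes "a \<in> S" "b \<in> S" "decomposition add U V a = decomposition add U V b"
  shows "a = b"
  using assms lpart_add_rpart by metis

lemma circ_inv:
  assumes a: "a \<in> S"
  shows "a \<odot> circ_inv a \<odot> a = a" "circ_inv a \<odot> a \<odot> circ_inv a = circ_inv a"
proof -
  note props = U.inverse_of_props[OF lpart_mem[OF a]] V.inverse_of_props[OF rpart_mem[OF a]]
  have assoc: "\<And>x y z. x \<in> V \<Longrightarrow> y \<in> V \<Longrightarrow> z \<in> V \<Longrightarrow> x \<oplus> (y \<oplus> z) = x \<oplus> y \<oplus> z"
    by (simp add: V.assoc)
  note simps = decomposition_circ decomposition_circ_inv circ_closed circ_inv_closed
  show "a \<odot> circ_inv a \<odot> a = a"
    using a props by (intro eq_by_decomposition) (simp_all add: simps assoc rpart_mem prod_eq_iff)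
  show "circ_inv a \<odot> a \<odot> circ_inv a = circ_inv a"
    using a props by (intro eq_by_decomposition) (simp_all add: simps assoc rpart_mem)
qed

subsection \<open>The brace axioms\<close>

lemma inverse_of_parts:
  assumes "a \<in> S"
  shows "S.inverse_of a = S.inverse_of (rpart a) \<oplus> S.inverse_of (lpart a)"
  using S.inverse_of_mult[OF U_subset[OF lpart_mem[OF assms]] V_subset[OF rpart_mem[OF assms]]]
  by (simp add: lpart_add_rpart[OF assms])

lemma circ_distrib:
  assumes a: "a \<in> S" and b: "b \<in> S" and c: "c \<in> S"
  shows "a \<odot> (b \<oplus> c) = a \<odot> b \<oplus> S.inverse_of a \<oplus> a \<odot> c"
proof -
  define u v where "u = lpart a" and "v = rpart a"
  have u: "u \<in> S" and v: "v \<in> S"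
    using a lpart_mem rpart_mem U_subset V_subset by (auto simp: u_def v_def)
  note inv = S.inverse_of_closed[OF u] S.inverse_of_closed[OF v]
  note idem = S.idem_of_closed[OF u] S.idem_of_closed[OF v]
  note mem = u v b c inv idem
  have "a \<odot> b \<oplus> S.inverse_of a \<oplus> a \<odot> c
      = (u \<oplus> b \<oplus> v) \<oplus> (S.inverse_of v \<oplus> S.inverse_of u) \<oplus> (u \<oplus> c \<oplus> v)"
    by (simp add: circ_parts inverse_of_parts[OF a] u_def v_def)
  also have "\<dots> = (u \<oplus> b) \<oplus> (v \<oplus> S.inverse_of v) \<oplus> (S.inverse_of u \<oplus> u) \<oplus> (c \<oplus> v)"
    using mem by (simp add: S.assoc S.closed)
  also have "\<dots> = (u \<oplus> b) \<oplus> S.idem_of v \<oplus> S.idem_of u \<oplus> (c \<oplus> v)"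
    by (simp add: S.mult_inverse_eq[OF v] S.inverse_mult_eq[OF u])
  also have "\<dots> = S.idem_of u \<oplus> ((u \<oplus> b) \<oplus> S.idem_of v) \<oplus> (c \<oplus> v)"
    using mem S.idem_of_commute[OF u, of "(u \<oplus> b) \<oplus> S.idem_of v"] by (simp add: S.closed)
  also have "\<dots> = S.idem_of u \<oplus> (u \<oplus> b) \<oplus> (S.idem_of v \<oplus> (c \<oplus> v))"
    using mem by (simp add: S.assoc S.closed)
  also have "\<dots> = (S.idem_of u \<oplus> u) \<oplus> b \<oplus> (c \<oplus> (v \<oplus> S.idem_of v))"
    using mem S.idem_of_commute[OF v, of "c \<oplus> v"] by (simp add: S.assoc S.closed)
  also have "\<dots> = u \<oplus> (b \<oplus> c) \<oplus> v"
    using mem by (simp add: S.idem_of_mult S.mult_idem_of S.assoc S.closed)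
  finally show ?thesis
    by (simp add: circ_parts u_def v_def)
qed

lemma circ_circ_inv:
  assumes a: "a \<in> S"
  shows "a \<odot> circ_inv a = S.inverse_of a \<oplus> a"
proof -
  define u v where "u = lpart a" and "v = rpart a"
  have u: "u \<in> S" and v: "v \<in> S" and uv: "a = u \<oplus> v"
    using a lpart_mem rpart_mem U_subset V_subset lpart_add_rpart by (auto simp: u_def v_def)
  have ci: "circ_inv a = S.inverse_of u \<oplus> S.inverse_of v"
    using a by (simp add: circ_inv_def U_inverse_of V_inverse_of lpart_mem rpart_mem u_def v_def)
  note inv = S.inverse_of_closed[OF u] S.inverse_of_closed[OF v]
  note idem = S.idem_of_closed[OF u] S.idem_of_closed[OF v]
  note mem = u v inv idem
  have "a \<odot> circ_inv a = (u \<oplus> S.inverse_of u) \<oplus> (S.inverse_of v \<oplus> v)"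
    unfolding circ_parts ci u_def[symmetric] v_def[symmetric]
    using mem by (simp add: S.assoc S.closed)
  also have "\<dots> = S.idem_of u \<oplus> (S.inverse_of v \<oplus> v)"
    by (simp add: S.mult_inverse_eq[OF u])
  also have "\<dots> = S.inverse_of v \<oplus> (S.idem_of u \<oplus> v)"
    using mem S.idem_of_commute[OF u, of "S.inverse_of v"] by (metis S.assoc)
  also have "\<dots> = S.inverse_of v \<oplus> ((S.inverse_of u \<oplus> u) \<oplus> v)"
    by (simp add: S.inverse_mult_eq[OF u])
  also have "\<dots> = (S.inverse_of v \<oplus> S.inverse_of u) \<oplus> (u \<oplus> v)"
    using mem by (simp add: S.assoc S.closed)
  finally show ?thesis
    unfolding inverse_of_parts[OF a, folded u_def v_def] uv[symmetric] .
qed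

lemma weak_brace_circ: "weak_brace S add circ"
  using circ_distrib circ_circ_inv
  by (rule weak_braceI[OF S.inverse_semigroup_axioms inverse_semigroup_circ, rotated 2])
    (simp_all add: S.inverse_of_props circ_inv circ_inv_closed)

subsection \<open>The operation on the two factors\<close>

text \<open>The idempotent of \<open>rpart a\<close> is absorbed by \<open>a\<close> from the right.  For \<open>a \<in> U\<close> this yields a
  decomposition with first component \<open>a\<close>, which must be the one of \<open>a\<close>.\<close>

lemma decomposition_of_U:
  assumes a: "a \<in> U"
  shows "decomposition add U V a = (a, V.idem_of (rpart a))" "a \<oplus> V.idem_of (rpart a) = a"
proof -
  have aS: "a \<in> S"
    using a by (rule U_subset)
  note v = rpart_mem[OF aS]
  have "a \<oplus> V.idem_of (rpart a) = lpart a \<oplus> (rpart a \<oplus> V.idem_of (rpart a))"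
    using lpart_add_rpart[OF aS] S.assoc U_subset[OF lpart_mem[OF aS]] V_subset[OF v]
      V_subset[OF V.idem_of_closed[OF v]] by metis
  then show eq: "a \<oplus> V.idem_of (rpart a) = a"
    by (simp add: V.mult_idem_of[OF v] lpart_add_rpart[OF aS])
  show "decomposition add U V a = (a, V.idem_of (rpart a))"
    using decomposition_add[OF a V.idem_of_closed[OF v]] unfolding eq .
qed

lemma decomposition_of_V:
  assumes a: "a \<in> V"
  shows "decomposition add U V a = (U.idem_of (lpart a), a)" "U.idem_of (lpart a) \<oplus> a = a"
proof -
  have aS: "a \<in> S"
    using a by (rule V_subset)
  note u = lpart_mem[OF aS]
  have "U.idem_of (lpart a) \<oplus> a = (U.idem_of (lpart a) \<oplus> lpart a) \<oplus> rpart a"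
    using lpart_add_rpart[OF aS] S.assoc V_subset[OF rpart_mem[OF aS]] U_subset[OF u]
      U_subset[OF U.idem_of_closed[OF u]] by metis
  then show eq: "U.idem_of (lpart a) \<oplus> a = a"
    by (simp add: U.idem_of_mult[OF u] lpart_add_rpart[OF aS])
  show "decomposition add U V a = (U.idem_of (lpart a), a)"
    using decomposition_add[OF U.idem_of_closed[OF u] a] unfolding eq .
qed

lemma circ_on_U:
  assumes a: "a \<in> U" and b: "b \<in> U"
  shows "a \<odot> b = a \<oplus> b"
proof -
  define e where "e = V.idem_of (rpart a)"
  have v: "rpart a \<in> V"
    using a by (intro rpart_mem U_subset)
  have e: "e \<in> S" "e \<oplus> e = e"
    using V.idem_of_closed[OF v] V.idem_of_idem[OF v] V_subset by (auto simp: e_def)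
  have "a \<odot> b = a \<oplus> b \<oplus> e"
    using decomposition_of_U(1)[OF a, folded e_def] by (simp add: factorization_circ_def)
  also have "\<dots> = a \<oplus> e \<oplus> b"
    using S.idem_central[OF e U_subset[OF b]] e U_subset[OF a] U_subset[OF b] by (simp add: S.assoc)
  finally show ?thesis
    using decomposition_of_U(2)[OF a] by (simp add: e_def)
qed

lemma circ_on_V:
  assumes a: "a \<in> V" and b: "b \<in> V"
  shows "a \<odot> b = b \<oplus> a"
proof -
  define e where "e = U.idem_of (lpart a)"
  have u: "lpart a \<in> U"
    using a by (intro lpart_mem V_subset)
  have e: "e \<in> S" "e \<oplus> e = e"
    using U.idem_of_closed[OF u] U.idem_of_idem[OF u] U_subset by (auto simp: e_def)
  have "a \<odot> b = e \<oplus> b \<oplus> a"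
    using decomposition_of_V(1)[OF a, folded e_def] by (simp add: factorization_circ_def)
  also have "\<dots> = b \<oplus> (e \<oplus> a)"
    using S.idem_central[OF e V_subset[OF b]] e V_subset[OF a] V_subset[OF b] by (simp add: S.assoc)
  finally show ?thesis
    using decomposition_of_V(2)[OF a] by (simp add: e_def)
qed

end

theorem theorem24:
  fixes S U V :: "'a set" and add :: "'a \<Rightarrow> 'a \<Rightarrow> 'a"
  assumes "clifford_semigroup S add"
    and "exact_factorization S add U V"
    and "clifford_semigroup U add"
    and "clifford_semigroup V add"
  shows "weak_brace S add (factorization_circ add U V)
    \<and> semigroups_isomorphic S (factorization_circ add U V) (U \<times> V) (direct_product_op add add)
    \<and> trivial_weak_brace U add (factorization_circ add U V)
    \<and> almost_trivial_weak_brace V add (factorization_circ add U V)"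
proof -
  interpret clifford_factorization S U V add
    using assms by (simp add: clifford_factorization_def clifford_factorization_axioms_def)
  show ?thesis
    using weak_brace_circ bij_betw_product_map product_map_circ
      U.trivial_weak_brace_self[OF circ_on_U] V.almost_trivial_weak_brace_self[OF circ_on_V]
    by (auto simp: semigroups_isomorphic_def)
qed

end
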